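(* For each positive integer $n$, let $x_n$ be the real number $x_n = 0.(n)(n+1)(n+2)(n+3)\dots$, whose decimal expansion after the decimal point is obtained by concatenating the decimal representations of all natural numbers from $n$ onwards, in increasing order. For example, $x_{20}=0.202122232425\dots$. Then the sequence $(x_n)_{n\ge 1}$ is not uniformly distributed modulo $1$ over $[0.1,1)$.
   Context: For a real number $x$, $\{x\}$ denotes its fractional part. For a sequence of real numbers $(x_n)_n$, a set $E\subseteq[0,1]$ and $N\ge 1$, $A(E;N;(x_n)_n)$ denotes the number of indices $n$ with $1\le n\le N$ and $\{x_n\}\in E$. A sequence $(x_n)_n$ is called uniformly distributed modulo $1$ over $[\alpha,\beta)\subseteq[0,1)$ if for every pair of reals $\alpha\le a<b\le\beta$, $$\lim_{N\to\infty}\frac{A([a,b);N;(x_n)_n)}{N}=\frac{b-a}{\beta-\alpha}.$$ *)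

theory Defs
  imports Complex_Main "HOL-Library.Stream"
begin

text \<open>Decimal digits of a natural number, most significant digit first, without leading zeros.\<close>

fun dec_digits :: "nat \<Rightarrow> nat list" where
  "dec_digits n = (if n < 10 then [n] else dec_digits (n div 10) @ [n mod 10])"

declare dec_digits.simps [simp del]

lemma dec_digits_not_Nil: "dec_digits n \<noteq> []"
  by (subst dec_digits.simps) simp

text \<open>
  The stream of digits obtained by writing \<open>n, n + 1, n + 2, \<dots>\<close> one after another. No
  \<open>dec_digits k\<close> is empty, so \<open>flat\<close> is the plain infinite concatenation.
\<close>

definition concat_digits :: "nat \<Rightarrow> nat stream" where
  "concat_digits n = flat (smap dec_digits (fromN n))"

definition concat_real :: "nat \<Rightarrow> real" where
  "concat_real n = (\<Sum>k. real (concat_digits n !! k) / 10 ^ (k + 1))"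

text \<open>Sequences are indexed from 1: the value at index 0 is never counted.\<close>

definition count_frac_in :: "real set \<Rightarrow> nat \<Rightarrow> (nat \<Rightarrow> real) \<Rightarrow> nat" where
  "count_frac_in E N x = card {n. 1 \<le> n \<and> n \<le> N \<and> frac (x n) \<in> E}"

text \<open>Intended for \<open>0 \<le> \<alpha> < \<beta> \<le> 1\<close>.\<close>

definition uniformly_distributed_mod1_over :: "real \<Rightarrow> real \<Rightarrow> (nat \<Rightarrow> real) \<Rightarrow> bool" where
  "uniformly_distributed_mod1_over \<alpha> \<beta> x \<longleftrightarrow>
     (\<forall>a b. \<alpha> \<le> a \<and> a < b \<and> b \<le> \<beta> \<longrightarrow>
        (\<lambda>N. real (count_frac_in {a..<b} N x) / real N) \<longlonglongrightarrow> (b - a) / (\<beta> - \<alpha>))"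

end

theory Submission
  imports Defs
begin

text \<open>
  If \<open>10 ^ k \<le> n < 2 * 10 ^ k\<close>, then \<open>n\<close> has leading digit 1, so \<open>concat_real n\<close> lies in
  \<open>[0.1, 0.2]\<close>. Hence at least half of the first \<open>2 * 10 ^ k\<close> terms lie in \<open>[0.1, 0.3)\<close>, whereas
  uniform distribution would give this interval the limiting frequency 2/9. (The interval is taken
  longer than \<open>[0.1, 0.2)\<close> so that a tail of nines need not be excluded.)
\<close>

lemma dec_digits_le_9: "d \<in> set (dec_digits n) \<Longrightarrow> d \<le> 9"
proof (induction n rule: dec_digits.induct)
  case (1 n)
  then show ?case
    by (cases "n < 10") (auto simp: dec_digits.simps[of n])
qed

text \<open>Induction on \<open>k\<close>: passing from \<open>n\<close> to \<open>n div 10\<close>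
  drops the last digit, keeps the leading one, and carries the range for \<open>Suc k\<close> into
  the range for \<open>k\<close>.\<close>

lemma hd_dec_digits_eq_1:
  assumes "10 ^ k \<le> n" "n < 2 * 10 ^ k"
  shows "hd (dec_digits n) = 1"
  using assms
proof (induction k arbitrary: n)
  case 0
  then show ?case by (simp add: dec_digits.simps[of n])
next
  case (Suc k)
  then have "10 ^ k \<le> n div 10" "n div 10 < 2 * 10 ^ k"
    by (auto simp: less_eq_div_iff_mult_less_eq less_mult_imp_div_less mult.commute)
  then have "hd (dec_digits (n div 10)) = 1"
    by (rule Suc.IH)
  \<comment> \<open>This selects the recursive branch of \<open>dec_digits\<close>, where the head
    comes from the nonempty list \<open>dec_digits (n div 10)\<close>.\<close>
  moreover have "\<not> n < 10"
    using Suc.prems one_le_power[of "10::nat" k] unfolding power_Suc by linarith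
  ultimately show ?case
    by (simp add: dec_digits.simps[of n] dec_digits_not_Nil)
qed

lemma concat_digits_nth_le_9: "concat_digits n !! k \<le> 9"
proof -
  have "sset (concat_digits n) = (\<Union>xs\<in>sset (smap dec_digits (fromN n)). set xs)"
    unfolding concat_digits_def by (rule sset_flat) (metis dec_digits_not_Nil imageE stream.set_map)
  then have "concat_digits n !! k \<in> (\<Union>xs\<in>sset (smap dec_digits (fromN n)). set xs)"
    using snth_sset by metis
  then show ?thesis by (auto simp: stream.set_map intro: dec_digits_le_9)
qed

lemma concat_digits_nth_0: "concat_digits n !! 0 = hd (dec_digits n)"
  unfolding concat_digits_def
  by (subst flat_unfold) (simp_all add: dec_digits_not_Nil)

text \<open>The digits after the first contribute at least 0 (all zeros) and at most 1/10 (all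
  nines).\<close>

lemma concat_real_bounds:
  defines "d \<equiv> \<lambda>n. real (hd (dec_digits n))"
  shows "d n / 10 \<le> concat_real n" "concat_real n \<le> (d n + 1) / 10"
proof -
  define f where "f k = real (concat_digits n !! k) / 10 ^ (k + 1)" for k
  have nonneg: "0 \<le> f k" for k by (simp add: f_def)
  \<comment> \<open>The bound is the value of a digit 9 in decimal place \<open>k + 2\<close>; these
    values form a geometric series with sum 1/10.\<close>
  have upper: "f (Suc k) \<le> 9 / 100 * (1 / 10) ^ k" for k
    using concat_digits_nth_le_9[of n "Suc k"] by (simp add: f_def field_simps)
  have geom: "(\<lambda>k. 9 / 100 * (1 / 10) ^ k :: real) sums (1 / 10)"
    using sums_mult[OF geometric_sums[of "1 / 10 :: real"], of "9 / 100"] by simp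
  have tail: "summable (\<lambda>k. f (Suc k))"
    using upper nonneg by (intro summable_comparison_test'[OF sums_summable[OF geom], of 0]) simp
  have "concat_real n = f 0 + (\<Sum>k. f (Suc k))"
    using suminf_split_head[of f] tail
    unfolding concat_real_def f_def[symmetric] summable_Suc_iff by simp
  moreover have "f 0 = d n / 10"
    by (simp add: f_def d_def concat_digits_nth_0 del: snth.simps)
  moreover have "0 \<le> (\<Sum>k. f (Suc k))"
    using tail nonneg by (rule suminf_nonneg)
  moreover have "(\<Sum>k. f (Suc k)) \<le> 1 / 10"
    using suminf_le[OF upper tail sums_summable[OF geom]] sums_unique[OF geom] by simp
  ultimately show "d n / 10 \<le> concat_real n" "concat_real n \<le> (d n + 1) / 10"
    by (simp_all add: add_divide_distrib)
qed

lemma count_frac_in_concat_real_ge: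
  "10 ^ k \<le> count_frac_in {1 / 10..<3 / 10} (2 * 10 ^ k) concat_real"
proof -
  have "frac (concat_real n) \<in> {1 / 10..<3 / 10}" if "n \<in> {10 ^ k..<2 * 10 ^ k}" for n
  proof -
    have "1 / 10 \<le> concat_real n" "concat_real n \<le> 2 / 10"
      using concat_real_bounds[of n] hd_dec_digits_eq_1[of k n] that by simp_all
    \<comment> \<open>The bounds place the value in [0, 1), where \<open>frac\<close> is the
      identity.\<close>
    moreover from this have "frac (concat_real n) = concat_real n"
      by (simp add: frac_eq)
    ultimately show ?thesis by simp
  qed
  moreover have "1 \<le> n" if "10 ^ k \<le> n" for n :: nat
    using that one_le_power[of "10::nat" k] by linarith
  ultimately have "{10 ^ k..<2 * 10 ^ k} \<subseteq>
      {n. 1 \<le> n \<and> n \<le> 2 * 10 ^ k \<and> frac (concat_real n) \<in> {1 / 10..<3 / 10}}"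
    by auto
  from card_mono[OF _ this] show ?thesis
    by (simp add: count_frac_in_def)
qed

theorem theorem1:
  "\<not> uniformly_distributed_mod1_over (1 / 10) 1 concat_real"
proof
  let ?c = "\<lambda>N. real (count_frac_in {1 / 10..<3 / 10} N concat_real) / real N"
  assume "uniformly_distributed_mod1_over (1 / 10) 1 concat_real"
  then have "?c \<longlonglongrightarrow> (3 / 10 - 1 / 10) / (1 - 1 / 10)"
    unfolding uniformly_distributed_mod1_over_def
    by (elim allE[of _ "1 / 10"] allE[of _ "3 / 10"] impE) simp_all
  then have "?c \<longlonglongrightarrow> 2 / 9" by simp
  then have "\<forall>\<^sub>F N in sequentially. ?c N < 1 / 2"
    by (rule order_tendstoD) simp
  then obtain M where M: "?c N < 1 / 2" if "M \<le> N" for N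
    by (auto simp: eventually_sequentially)
  \<comment> \<open>The contradiction comes at \<open>N = 2 * 10 ^ M\<close>: it lies beyond
    \<open>M\<close>, yet at least \<open>10 ^ M\<close> of its indices are counted, so the ratio is
    at least 1/2.\<close>
  have "M < 10 ^ M" by (rule power_gt_expt) simp
  then have "?c (2 * 10 ^ M) < 1 / 2" by (intro M) simp
  moreover have "(10::real) ^ M \<le> real (count_frac_in {1 / 10..<3 / 10} (2 * 10 ^ M) concat_real)"
    using count_frac_in_concat_real_ge[of M] by (metis of_nat_le_iff of_nat_numeral of_nat_power)
  ultimately show False by (simp add: field_simps)
qed

end
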